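(* Assume $M$ is irreducible and aperiodic, with unique invariant distribution $\pi$. Then for every prior $q\in\Delta(K)$ and every $n\ge 2$, $$v_n(q)-v_\infty(\pi)\ \ge\ -\frac{d_{\lceil n/2\rceil}(M)}{\min_{i\in K}\pi(i)}-\left(1-\frac1k\right)^{\lfloor n/2\rfloor-1}$$ and $$v_n(q)-v_\infty(\pi)\ \le\ \frac{\mathcal W_{n-1}(M)}{\min(M^{k^2})}+\left(1-\frac1k\right)^{n-2}.$$
   Context: Setting: $K=\{1,\dots,k\}$ is a finite set, $\Delta(K)$ is the set of probability distributions on $K$ (viewed as $k$-dimensional row vectors; $q(i)$ is the mass of $i$ under $q$), $M$ is a $k\times k$ stochastic matrix, and $u:K\times K\to[0,1]$ is a utility function. For a prior $q\in\Delta(K)$, $\{X_j\}_{j\ge1}$ is the Markov chain on $K$ with $X_1\sim q$ and transition matrix $M$. At each stage $j=1,2,\dots$ a decision maker selects an action $\xi_j\in K$ and then observes only the binary signal $I(\xi_j)=\mathbf 1\{X_j=\xi_j\}$. A policy $\xi=(\xi_j)_{j\ge1}$ specifies each action $\xi_j$ as a (deterministic) function of the past actions $\xi_1,\dots,\xi_{j-1}$ and past signals $I(\xi_1),\dots,I(\xi_{j-1})$ (so $\xi_1$ is a fixed element of $K$). Let $\Xi$ be the set of all policies, and let $P_{q,\xi}$, $E_{q,\xi}$ denote the induced probability and expectation. The value of the $n$-stage problem is $$v_n(q)=\max_{\xi\in\Xi}E_{q,\xi}[u(X_n,\xi_n)].$$ For an invariant distribution $\pi$ the sequence $v_n(\pi)$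 is non-decreasing and bounded, and $v_\infty(\pi)=\lim_{n\to\infty}v_n(\pi)$. Further notation: $d_n(M)=\sup_{q\in\Delta(K)}\|qM^n-\pi\|_1$, where $\|\cdot\|_1$ is the $\ell_1$-norm; $\min(A)$ denotes the smallest entry of a matrix $A$ (for irreducible aperiodic $M$ one has $\min(M^{k^2})>0$); and $$\mathcal W_n(M)=\sup_{q\in\Delta(K)}\max_{\xi\in\Xi}P_{q,\xi}(X_1\ne\xi_1,\dots,X_n\ne\xi_n).$$ Convention: $0^0=1$. *)

theory Defs
  imports "HOL-Analysis.Analysis" "HOL-Probability.Probability"
begin

section \<open>Distributions and stochastic matrices\<close>

text \<open>The finite set \<open>K\<close> is the universe of a finite type \<open>'k\<close>, so \<open>k = CARD('k)\<close>.
  A vector \<open>q\<close> acts as a row vector, so \<open>q M\<close> is \<open>q v* M\<close>.\<close>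

definition prob_simplex :: "(real ^ 'k::finite) set" where
  "prob_simplex = {q. (\<forall>i. 0 \<le> q $ i) \<and> (\<Sum>i\<in>UNIV. q $ i) = 1}"

definition stochastic_matrix :: "real ^ 'k ^ 'k::finite \<Rightarrow> bool" where
  "stochastic_matrix M \<longleftrightarrow> (\<forall>i. row i M \<in> prob_simplex)"

text \<open>The operation \<open>^\<close> is not available here: multiplication on \<open>real ^ 'k ^ 'k\<close>
  is componentwise.\<close>

definition mat_power :: "real ^ 'k ^ 'k::finite \<Rightarrow> nat \<Rightarrow> real ^ 'k ^ 'k" where
  "mat_power M n = (((**) M) ^^ n) (mat 1)"

definition irreducible_matrix :: "real ^ 'k ^ 'k::finite \<Rightarrow> bool" where
  "irreducible_matrix M \<longleftrightarrow> (\<forall>i j. \<exists>n. 0 < mat_power M n $ i $ j)"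

definition aperiodic_matrix :: "real ^ 'k ^ 'k::finite \<Rightarrow> bool" where
  "aperiodic_matrix M \<longleftrightarrow> (\<forall>i. Gcd {n::nat. 0 < n \<and> 0 < mat_power M n $ i $ i} = 1)"

definition invariant_distribution :: "real ^ 'k ^ 'k::finite \<Rightarrow> real ^ 'k \<Rightarrow> bool" where
  "invariant_distribution M \<pi> \<longleftrightarrow> \<pi> \<in> prob_simplex \<and> \<pi> v* M = \<pi>"

definition l1_norm :: "real ^ 'k::finite \<Rightarrow> real" where
  "l1_norm x = (\<Sum>i\<in>UNIV. \<bar>x $ i\<bar>)"

definition min_entry :: "real ^ 'k ^ 'k::finite \<Rightarrow> real" where
  "min_entry A = Min {A $ i $ j | i j. True}"

definition mixing_distance :: "real ^ 'k ^ 'k::finite \<Rightarrow> real ^ 'k \<Rightarrow> nat \<Rightarrow> real" where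
  "mixing_distance M \<pi> n = (SUP q\<in>prob_simplex. l1_norm (q v* mat_power M n - \<pi>))"


section \<open>The Markov chain\<close>

text \<open>\<open>pmf_of_vec q\<close> is meaningful for \<open>q \<in> prob_simplex\<close>.\<close>

definition pmf_of_vec :: "real ^ 'k::finite \<Rightarrow> 'k pmf" where
  "pmf_of_vec q = embed_pmf (\<lambda>i. q $ i)"

lemma pmf_pmf_of_vec:
  assumes "q \<in> prob_simplex"
  shows "pmf (pmf_of_vec q) i = q $ i"
proof -
  have "(\<integral>\<^sup>+ x. ennreal (q $ x) \<partial>count_space UNIV) = (\<Sum>x\<in>UNIV. ennreal (q $ x))"
    by (rule nn_integral_count_space_finite) simp
  also have "\<dots> = ennreal (\<Sum>x\<in>UNIV. q $ x)"
    using assms by (intro sum_ennreal) (auto simp: prob_simplex_def)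
  also have "\<dots> = 1"
    using assms by (simp add: prob_simplex_def)
  finally show ?thesis
    unfolding pmf_of_vec_def using assms
    by (subst pmf_embed_pmf) (auto simp: prob_simplex_def)
qed

text \<open>Joint law of \<open>[X\<^sub>1, \<dots>, X\<^sub>n]\<close> for the chain with initial law \<open>q\<close> and transition
  matrix \<open>M\<close>: given \<open>X\<^sub>1 = x\<close>, the chain restarts from row \<open>x\<close> of \<open>M\<close>.\<close>

primrec chain_pmf :: "real ^ 'k ^ 'k::finite \<Rightarrow> real ^ 'k \<Rightarrow> nat \<Rightarrow> 'k list pmf" where
  "chain_pmf M q 0 = return_pmf []"
| "chain_pmf M q (Suc n) =
     bind_pmf (pmf_of_vec q) (\<lambda>x. map_pmf (Cons x) (chain_pmf M (row x M) n))"

text \<open>Stages are numbered from 1, list positions from 0.\<close>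

definition state :: "'k list \<Rightarrow> nat \<Rightarrow> 'k" where
  "state xs j = xs ! (j - 1)"


section \<open>Policies and values\<close>

text \<open>A history lists the past pairs of action and signal, oldest first; the signal is
  \<open>True\<close> iff the action equalled the state.  In \<open>action\<close>, the stage \<open>j\<close> is at least 1.\<close>

type_synonym 'k policy = "('k \<times> bool) list \<Rightarrow> 'k"

primrec history :: "'k policy \<Rightarrow> 'k list \<Rightarrow> nat \<Rightarrow> ('k \<times> bool) list" where
  "history \<xi> xs 0 = []"
| "history \<xi> xs (Suc j) =
     (let h = history \<xi> xs j; a = \<xi> h in h @ [(a, state xs (Suc j) = a)])"

definition action :: "'k policy \<Rightarrow> 'k list \<Rightarrow> nat \<Rightarrow> 'k" where
  "action \<xi> xs j = \<xi> (history \<xi> xs (j - 1))"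

definition policy_payoff ::
  "('k \<Rightarrow> 'k \<Rightarrow> real) \<Rightarrow> real ^ 'k ^ 'k::finite \<Rightarrow> nat \<Rightarrow> real ^ 'k \<Rightarrow> 'k policy \<Rightarrow> real" where
  "policy_payoff u M n q \<xi> =
     measure_pmf.expectation (chain_pmf M q n) (\<lambda>xs. u (state xs n) (action \<xi> xs n))"

definition miss_prob :: "real ^ 'k ^ 'k::finite \<Rightarrow> nat \<Rightarrow> real ^ 'k \<Rightarrow> 'k policy \<Rightarrow> real" where
  "miss_prob M n q \<xi> =
     measure_pmf.prob (chain_pmf M q n) {xs. \<forall>j\<in>{1..n}. state xs j \<noteq> action \<xi> xs j}"

text \<open>The set of policies is infinite, but only decisions at histories shorter than the horizon
  matter (for positive horizon), so the maxima below range over finite sets; see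
  \<open>finite_range_policy_payoff\<close> and \<open>finite_range_miss_prob\<close>.\<close>

definition stage_value ::
  "('k \<Rightarrow> 'k \<Rightarrow> real) \<Rightarrow> real ^ 'k ^ 'k::finite \<Rightarrow> nat \<Rightarrow> real ^ 'k \<Rightarrow> real" where
  "stage_value u M n q = Max (range (policy_payoff u M n q))"

definition limit_value ::
  "('k \<Rightarrow> 'k \<Rightarrow> real) \<Rightarrow> real ^ 'k ^ 'k::finite \<Rightarrow> real ^ 'k \<Rightarrow> real" where
  "limit_value u M \<pi> = lim (\<lambda>n. stage_value u M n \<pi>)"

definition max_miss_prob :: "real ^ 'k ^ 'k::finite \<Rightarrow> nat \<Rightarrow> real" where
  "max_miss_prob M n = (SUP q\<in>prob_simplex. Max (range (miss_prob M n q)))"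

lemma length_history: "length (history \<xi> xs j) = j"
  by (induction j) (auto simp: Let_def)

lemma history_cong:
  assumes "\<And>h. length h < n \<Longrightarrow> \<xi> h = \<xi>' h" and "j \<le> n"
  shows "history \<xi> xs j = history \<xi>' xs j"
  using assms(2)
proof (induction j)
  case (Suc j)
  then have "history \<xi> xs j = history \<xi>' xs j" by simp
  moreover from this have "\<xi> (history \<xi> xs j) = \<xi>' (history \<xi>' xs j)"
    using Suc.prems assms(1)[of "history \<xi>' xs j"] by (simp add: length_history)
  ultimately show ?case by (simp add: Let_def)
qed simp

lemma action_cong:
  assumes "\<And>h. length h < n \<Longrightarrow> \<xi> h = \<xi>' h" and "0 < n" and "j \<le> n"
  shows "action \<xi> xs j = action \<xi>' xs j"
proof -
  have "history \<xi> xs (j - 1) = history \<xi>' xs (j - 1)"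
    using assms by (intro history_cong[of n]) auto
  then show ?thesis
    using assms by (simp add: action_def length_history)
qed

lemma finite_range_policy:
  fixes g :: "'k::finite policy \<Rightarrow> real"
  assumes "\<And>\<xi> \<xi>'. (\<And>h. length h < n \<Longrightarrow> \<xi> h = \<xi>' h) \<Longrightarrow> g \<xi> = g \<xi>'"
  shows "finite (range g)"
proof -
  define S where "S = {h :: ('k \<times> bool) list. length h < n}"
  have "finite {h :: ('k \<times> bool) list. set h \<subseteq> UNIV \<and> length h \<le> n}"
    by (rule finite_lists_length_le) simp
  then have "finite S"
    unfolding S_def by (rule rev_finite_subset) auto
  then have "finite (S \<rightarrow>\<^sub>E (UNIV :: 'k set))"
    by (intro finite_PiE) auto
  moreover have "g \<xi> \<in> g ` (S \<rightarrow>\<^sub>E UNIV)" for \<xi>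
  proof (rule image_eqI)
    show "g \<xi> = g (restrict \<xi> S)" by (rule assms) (simp add: S_def)
  qed auto
  ultimately show ?thesis
    by (meson finite_imageI finite_subset image_subsetI)
qed

lemma finite_range_policy_payoff:
  assumes "0 < n"
  shows "finite (range (policy_payoff u (M :: real ^ 'k ^ 'k::finite) n q))"
proof (rule finite_range_policy[where n = n])
  fix \<xi> \<xi>' :: "'k policy"
  assume "\<And>h. length h < n \<Longrightarrow> \<xi> h = \<xi>' h"
  then have "action \<xi> xs n = action \<xi>' xs n" for xs
    using assms by (intro action_cong[of n]) auto
  then show "policy_payoff u M n q \<xi> = policy_payoff u M n q \<xi>'"
    by (simp add: policy_payoff_def)
qed

lemma finite_range_miss_prob: "finite (range (miss_prob (M :: real ^ 'k ^ 'k::finite) n q))"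
proof (rule finite_range_policy[where n = n])
  fix \<xi> \<xi>' :: "'k policy"
  assume eq: "\<And>h. length h < n \<Longrightarrow> \<xi> h = \<xi>' h"
  have "action \<xi> xs j = action \<xi>' xs j" if "j \<in> {1..n}" for xs j
    using that by (intro action_cong[of n] eq) auto
  then show "miss_prob M n q \<xi> = miss_prob M n q \<xi>'"
    by (simp add: miss_prob_def)
qed

end

theory Submission
  imports Defs
begin

text \<open>
  Extended to unnormalised mass vectors, the value is sublinear in the prior and satisfies a dynamic
  programming recursion in which a miss of the guess \<open>a\<close> removes the mass at \<open>a\<close>.

  Lower bound: ignoring the first signals gives \<open>v\<^sub>n(q) \<ge> v\<^sub>b(q M\<^sup>a)\<close> for \<open>a + b = n\<close>, and the value is
  1-Lipschitz in the prior.  From \<open>\<pi>\<close>, guess uniformly at random until the first hit.  The time of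
  that hit is independent of the path, so the state revealed has law \<open>\<pi>\<close>, and knowing a
  \<open>\<pi>\<close>-distributed state exactly is worth at least \<open>v\<^sub>\<infinity>(\<pi>)\<close>.  Only the event of no hit is lost.

  Upper bound: a decision maker with prior \<open>\<pi>\<close> guesses along a simulated chain started from \<open>q\<close>.
  Given the simulated path, the probability of never hitting is at most \<open>W\<^sub>n\<^sub>-\<^sub>1\<close>, and a hit
  means that the two chains have met.  Hence \<open>v\<^sub>n(q) \<le> v\<^sub>n(\<pi>) + W\<^sub>n\<^sub>-\<^sub>1\<close>, while \<open>v\<^sub>n(\<pi>)\<close> increases to
  \<open>v\<^sub>\<infinity>(\<pi>)\<close>.

  The divisors \<open>min \<pi>\<close> and \<open>min (M ^ k\<^sup>2)\<close> only matter through being in \<open>(0, 1]\<close>; since \<open>x / 0 = 0\<close>,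
  their positivity does have to be proved.
\<close>

lemma add_closed_eventually:
  fixes S :: "nat set"
  assumes add: "\<And>a b. a \<in> S \<Longrightarrow> b \<in> S \<Longrightarrow> a + b \<in> S"
    and zero: "0 \<in> S" and gcd: "Gcd S = 1"
  shows "\<exists>N. \<forall>n\<ge>N. n \<in> S"
proof -
  have mult: "m * a \<in> S" if "a \<in> S" for m a
    by (induction m) (auto simp: zero intro: add that)
  define D where "D = {d. 0 < d \<and> (\<exists>b\<in>S. b + d \<in> S)}"
  have "\<exists>a\<in>S. a \<noteq> 0"
  proof (rule ccontr)
    assume "\<not> ?thesis"
    with zero have "S = {0}" by auto
    with gcd show False by simp
  qed
  then have "\<exists>d. d \<in> D"
    using zero by (auto simp: D_def intro!: bexI[of _ 0])
  define d where "d = (LEAST d. d \<in> D)"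
  have d: "d \<in> D" unfolding d_def using \<open>\<exists>d. d \<in> D\<close> by (rule LeastI_ex)
  have d_le: "d \<le> d'" if "d' \<in> D" for d' unfolding d_def using that by (rule Least_le)
  obtain b where b: "b \<in> S" "b + d \<in> S" and "0 < d" using d by (auto simp: D_def)
  have "d dvd a" if "a \<in> S" for a
  proof (rule ccontr)
    assume "\<not> d dvd a"
    then have r: "0 < a mod d" by (simp add: mod_greater_zero_iff_not_dvd)
    have eq: "a = (a div d) * d + a mod d" by simp
    have "(a div d) * (b + d) + a mod d = (a div d) * b + a"
      using eq by (simp add: algebra_simps)
    moreover have "(a div d) * b + a \<in> S" by (intro add mult b that)
    ultimately have "a mod d \<in> D"
      using r mult[OF b(2), of "a div d"] by (auto simp: D_def intro!: bexI[of _ "(a div d) * (b + d)"])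
    then have "d \<le> a mod d" by (rule d_le)
    with mod_less_divisor[OF \<open>0 < d\<close>, of a] show False by simp
  qed
  then have "d dvd Gcd S" by (rule Gcd_greatest)
  with gcd have "d = 1" by simp
  have "n \<in> S" if "b * b \<le> n" for n
  proof (cases "b = 0")
    case True
    then show ?thesis using b \<open>d = 1\<close> mult[of 1 n] by simp
  next
    case False
    have "n mod b < b" using False by simp
    moreover have "b \<le> n div b" using that False
      by (simp add: less_eq_div_iff_mult_less_eq)
    ultimately have le: "n mod b \<le> n div b" by simp
    have "n = (n div b - n mod b) * b + (n mod b) * (b + 1)"
    proof -
      have "(n div b - n mod b) * b + (n mod b) * (b + 1) = (n div b - n mod b + n mod b) * b + n mod b"
        by (simp only: algebra_simps)
      then show ?thesis using le by simp
    qed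
    moreover have "(n div b - n mod b) * b + (n mod b) * (b + 1) \<in> S"
      using b \<open>d = 1\<close> by (intro add[OF mult mult]) auto
    ultimately show ?thesis by simp
  qed
  then show ?thesis by blast
qed

lemma increasing_iteration_stable:
  fixes A :: "nat \<Rightarrow> 'a::finite set"
  assumes step: "\<And>m. A (Suc m) = g (A m)" and mono: "\<And>m. A m \<subseteq> A (Suc m)"
    and ne: "A 0 \<noteq> {}"
  shows "A m \<subseteq> A (CARD('a) - 1)"
proof -
  have "\<exists>n < CARD('a). A (Suc n) = A n"
  proof (rule ccontr)
    assume "\<not> ?thesis"
    then have strict: "A n \<subset> A (Suc n)" if "n < CARD('a)" for n
      using that mono[of n] by blast
    have "n < card (A n)" if "n \<le> CARD('a)" for n
      using that
    proof (induction n)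
      case 0
      then show ?case using ne by (simp add: card_gt_0_iff)
    next
      case (Suc n)
      have "card (A n) < card (A (Suc n))"
        using Suc.prems by (intro psubset_card_mono strict) auto
      with Suc show ?case by simp
    qed
    from this[of "CARD('a)"] have "CARD('a) < card (A (CARD('a)))" by simp
    moreover have "card (A (CARD('a))) \<le> CARD('a)" by (rule card_mono) auto
    ultimately show False by simp
  qed
  then obtain n where n: "n < CARD('a)" "A (Suc n) = A n" by blast
  have stable: "A (n + j) = A n" for j
    by (induction j) (use n step in auto)
  have "A m \<subseteq> A (n + m)"
    by (rule lift_Suc_mono_le[of A, OF mono]) auto
  also have "\<dots> = A (n + (CARD('a) - 1 - n))" by (simp only: stable)
  also have "\<dots> = A (CARD('a) - 1)" using n by simp
  finally show ?thesis .
qed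

section \<open>Positivity of powers of a primitive matrix\<close>

lemma mat_power_0 [simp]: "mat_power M 0 = mat 1"
  and mat_power_Suc: "mat_power M (Suc n) = M ** mat_power M n"
  by (simp_all add: mat_power_def)

lemma mat_power_add: "mat_power M (m + n) = mat_power M m ** mat_power M n"
  by (induction m) (auto simp: mat_power_Suc matrix_mul_assoc)

lemma mat_power_1 [simp]: "mat_power M (Suc 0) = M"
  by (simp add: mat_power_Suc)

lemma matrix_mult_nth: "(A ** B) $ i $ j = (\<Sum>l\<in>UNIV. A $ i $ l * B $ l $ j)"
  by (simp add: matrix_matrix_mult_def)

lemma vector_matrix_mult_nth: "(q v* A) $ j = (\<Sum>i\<in>UNIV. q $ i * A $ i $ j)"
  by (simp add: vector_matrix_mult_def mult.commute)

lemma stochastic_nonneg: "stochastic_matrix M \<Longrightarrow> 0 \<le> M $ i $ j"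
  by (simp add: stochastic_matrix_def prob_simplex_def row_def)

lemma stochastic_sum: "stochastic_matrix M \<Longrightarrow> (\<Sum>j\<in>UNIV. M $ i $ j) = 1"
  by (simp add: stochastic_matrix_def prob_simplex_def row_def)

lemma stochastic_le_one: "stochastic_matrix M \<Longrightarrow> M $ i $ j \<le> 1"
  using member_le_sum[of j UNIV "\<lambda>j. M $ i $ j"]
  by (simp add: stochastic_nonneg stochastic_sum)

lemma vector_matrix_mult_nonneg:
  assumes "stochastic_matrix M" "\<And>i. 0 \<le> p $ i"
  shows "0 \<le> (p v* M) $ j"
  using assms by (auto simp: vector_matrix_mult_nth stochastic_nonneg intro!: sum_nonneg)

lemma sum_vector_matrix_mult:
  assumes "stochastic_matrix M"
  shows "(\<Sum>j\<in>UNIV. (p v* M) $ j) = (\<Sum>i\<in>UNIV. p $ i)"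
  unfolding vector_matrix_mult_nth
  by (subst sum.swap) (simp add: sum_distrib_left[symmetric] stochastic_sum[OF assms])

lemma stochastic_mat_power:
  assumes "stochastic_matrix M"
  shows "stochastic_matrix (mat_power M n)"
proof (induction n)
  case 0
  show ?case by (simp add: stochastic_matrix_def prob_simplex_def row_def mat_def)
next
  case (Suc n)
  have "row i (M ** mat_power M n) = row i M v* mat_power M n" for i
    by (simp add: vec_eq_iff row_def matrix_mult_nth vector_matrix_mult_nth)
  then show ?case
    using assms Suc vector_matrix_mult_nonneg[OF Suc] sum_vector_matrix_mult[OF Suc]
    by (simp add: mat_power_Suc stochastic_matrix_def prob_simplex_def)
qed

lemma mat_power_add_pos:
  assumes "stochastic_matrix M" "0 < mat_power M m $ i $ l" "0 < mat_power M n $ l $ j"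
  shows "0 < mat_power M (m + n) $ i $ j"
  unfolding mat_power_add matrix_mult_nth
  by (rule sum_pos2[of _ l])
    (use assms stochastic_nonneg[OF stochastic_mat_power[OF assms(1)]] in auto)

lemma mat_power_add_posE:
  assumes "stochastic_matrix M" "0 < mat_power M (m + n) $ i $ j"
  obtains l where "0 < mat_power M m $ i $ l" "0 < mat_power M n $ l $ j"
proof -
  have nn: "0 \<le> mat_power M n $ i $ j" for n i j
    by (rule stochastic_nonneg[OF stochastic_mat_power[OF assms(1)]])
  have "(\<Sum>l\<in>UNIV. mat_power M m $ i $ l * mat_power M n $ l $ j) \<noteq> 0"
    using assms(2) by (simp add: mat_power_add matrix_mult_nth)
  then obtain l where "mat_power M m $ i $ l * mat_power M n $ l $ j \<noteq> 0"
    by (meson sum.neutral)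
  then show thesis
    using that[of l] nn[of m i l] nn[of n l j] by (auto simp: less_le)
qed

lemma irreducible_reach:
  fixes M :: "real ^ 'k ^ 'k::finite"
  assumes "stochastic_matrix M" "irreducible_matrix M"
  shows "\<exists>t \<le> CARD('k) - 1. 0 < mat_power M t $ i $ j"
proof -
  define A where "A m = {j. \<exists>t\<le>m. 0 < mat_power M t $ i $ j}" for m
  have "A (Suc m) = A m \<union> {j. \<exists>l\<in>A m. 0 < M $ l $ j}" for m
  proof (intro set_eqI iffI)
    fix j assume "j \<in> A (Suc m)"
    then obtain t where t: "t \<le> Suc m" "0 < mat_power M t $ i $ j" by (auto simp: A_def)
    show "j \<in> A m \<union> {j. \<exists>l\<in>A m. 0 < M $ l $ j}"
    proof (cases "t \<le> m")
      case True
      with t show ?thesis by (auto simp: A_def)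
    next
      case False
      with t have "0 < mat_power M (m + Suc 0) $ i $ j" by (simp add: le_Suc_eq)
      then obtain l where "0 < mat_power M m $ i $ l" "0 < mat_power M (Suc 0) $ l $ j"
        by (rule mat_power_add_posE[OF assms(1)])
      then show ?thesis by (auto simp: A_def)
    qed
  next
    fix j assume "j \<in> A m \<union> {j. \<exists>l\<in>A m. 0 < M $ l $ j}"
    then consider "j \<in> A m" | l where "l \<in> A m" "0 < M $ l $ j" by blast
    then show "j \<in> A (Suc m)"
    proof cases
      case 1
      then show ?thesis by (auto simp: A_def intro: le_SucI)
    next
      case 2
      then obtain t where "t \<le> m" "0 < mat_power M t $ i $ l" by (auto simp: A_def)
      then have "0 < mat_power M (t + Suc 0) $ i $ j"
        using 2 by (intro mat_power_add_pos[OF assms(1)]) auto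
      then show ?thesis using \<open>t \<le> m\<close> by (auto simp: A_def intro!: exI[of _ "Suc t"])
    qed
  qed
  moreover have "A m \<subseteq> A (Suc m)" for m by (auto simp: A_def intro: le_SucI)
  moreover have "i \<in> A 0" by (simp add: A_def mat_def)
  ultimately have sub: "A m \<subseteq> A (CARD('k) - 1)" for m
    by (intro increasing_iteration_stable[of A "\<lambda>B. B \<union> {j. \<exists>l\<in>B. 0 < M $ l $ j}"]) auto
  obtain n where "0 < mat_power M n $ i $ j"
    using assms(2) by (auto simp: irreducible_matrix_def)
  then have "j \<in> A n" by (auto simp: A_def)
  with sub have "j \<in> A (CARD('k) - 1)" by blast
  then show ?thesis by (auto simp: A_def)
qed

text \<open>Wielandt's argument with a weaker constant: given a closed walk of length
  \<open>s \<le> k\<close> at \<open>i\<close>, the sets of states that \<open>M\<^sup>s\<close> reaches from \<open>i\<close> in \<open>m\<close> steps increase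
  with \<open>m\<close>, so they are everything from \<open>m = k - 1\<close> on.\<close>

lemma mat_power_card_squared_pos:
  fixes M :: "real ^ 'k ^ 'k::finite"
  assumes st: "stochastic_matrix M" and irr: "irreducible_matrix M" and ap: "aperiodic_matrix M"
  shows "0 < mat_power M (CARD('k) ^ 2) $ i $ j"
proof -
  let ?k = "CARD('k)"
  note add_pos = mat_power_add_pos[OF st]
  have pred: "\<exists>l. 0 < M $ l $ j" for j
  proof -
    have "{n::nat. 0 < n \<and> 0 < mat_power M n $ j $ j} \<noteq> {}"
      using ap by (metis aperiodic_matrix_def Gcd_empty zero_neq_one)
    then obtain n where "0 < n" "0 < mat_power M n $ j $ j" by blast
    then have "0 < mat_power M ((n - 1) + Suc 0) $ j $ j" by simp
    then obtain l where "0 < mat_power M (Suc 0) $ l $ j"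
      by (rule mat_power_add_posE[OF st])
    then show ?thesis by auto
  qed
  obtain s where s: "0 < s" "s \<le> ?k" "0 < mat_power M s $ i $ i"
  proof -
    obtain l where l: "0 < M $ l $ i" using pred by blast
    obtain t where "t \<le> ?k - 1" "0 < mat_power M t $ i $ l"
      using irreducible_reach[OF st irr] by blast
    then have "0 < mat_power M (t + Suc 0) $ i $ i" using l by (intro add_pos) auto
    moreover have "0 < ?k" by simp
    ultimately show thesis using \<open>t \<le> ?k - 1\<close> that[of "t + Suc 0"] by linarith
  qed
  have ret: "\<exists>N. \<forall>n\<ge>N. 0 < mat_power M n $ i $ i"
  proof -
    let ?S = "insert 0 {n::nat. 0 < n \<and> 0 < mat_power M n $ i $ i}"
    have "Gcd ?S = 1" using ap by (simp add: aperiodic_matrix_def)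
    then have "\<exists>N. \<forall>n\<ge>N. n \<in> ?S"
      by (intro add_closed_eventually) (auto intro: add_pos)
    then obtain N where "\<forall>n\<ge>N. n \<in> ?S" by blast
    then have "0 < mat_power M n $ i $ i" if "Suc N \<le> n" for n
      using that by (auto dest: spec[of _ n])
    then show ?thesis by blast
  qed
  define A where "A m = {j. 0 < mat_power M (m * s) $ i $ j}" for m
  have "A (Suc m) = {j. \<exists>l\<in>A m. 0 < mat_power M s $ l $ j}" for m
    using add_pos[of "m * s" i _ s] mat_power_add_posE[OF st, of "m * s" s i]
    by (fastforce simp: A_def add.commute)
  moreover have "A m \<subseteq> A (Suc m)" for m
    using s add_pos[of s i i "m * s"] by (auto simp: A_def)
  moreover have "i \<in> A 0" by (simp add: A_def mat_def)
  ultimately have sub: "A m \<subseteq> A (?k - 1)" for m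
    by (intro increasing_iteration_stable[of A "\<lambda>B. {j. \<exists>l\<in>B. 0 < mat_power M s $ l $ j}"]) auto
  have all: "0 < mat_power M ((?k - 1) * s) $ i $ j" for j
  proof -
    obtain N where N: "\<forall>n\<ge>N. 0 < mat_power M n $ i $ i" using ret by blast
    obtain t where t: "0 < mat_power M t $ i $ j"
      using irr by (auto simp: irreducible_matrix_def)
    have "N + t \<le> (N + t) * s" using s by simp
    then have "N \<le> (N + t) * s - t" by linarith
    then have "0 < mat_power M (((N + t) * s - t) + t) $ i $ j"
      by (intro add_pos[OF _ t]) (use N in blast)
    then have "j \<in> A (N + t)" using \<open>N + t \<le> (N + t) * s\<close> by (simp add: A_def)
    with sub show ?thesis by (auto simp: A_def)
  qed
  have ext: "\<forall>j. 0 < mat_power M ((?k - 1) * s + m) $ i $ j" for m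
  proof (induction m)
    case 0
    then show ?case using all by simp
  next
    case (Suc m)
    show ?case
    proof
      fix j
      obtain l where "0 < M $ l $ j" using pred by blast
      have "0 < mat_power M (((?k - 1) * s + m) + Suc 0) $ i $ j"
        by (rule add_pos[of _ _ l]) (use Suc \<open>0 < M $ l $ j\<close> in auto)
      then show "0 < mat_power M ((?k - 1) * s + Suc m) $ i $ j" by simp
    qed
  qed
  have "(?k - 1) * s \<le> ?k * ?k" by (intro mult_mono s) auto
  then show ?thesis
    using ext[of "?k * ?k - (?k - 1) * s"] by (simp add: power2_eq_square)
qed

section \<open>Dynamic programming\<close>

lemma finite_set_chain_pmf: "finite (set_pmf (chain_pmf M q n))"
  by (induction n arbitrary: q) auto

lemma expectation_chain_pmf_Suc:
  fixes f :: "'k::finite list \<Rightarrow> real"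
  assumes "q \<in> prob_simplex"
  shows "measure_pmf.expectation (chain_pmf M q (Suc n)) f =
    (\<Sum>x\<in>UNIV. q $ x * measure_pmf.expectation (chain_pmf M (row x M) n) (\<lambda>xs. f (x # xs)))"
  by (simp add: pmf_expectation_bind[of UNIV] finite_set_chain_pmf pmf_pmf_of_vec[OF assms])

text \<open>Mass vector of the next state on the event that action \<open>a\<close> missed.\<close>

definition miss_update :: "real ^ 'k ^ 'k::finite \<Rightarrow> real ^ 'k \<Rightarrow> 'k \<Rightarrow> real ^ 'k" where
  "miss_update M p a = (\<chi> i. if i = a then 0 else p $ i) v* M"

lemma miss_update_nth: "miss_update M p a $ j = (p v* M) $ j - p $ a * M $ a $ j"
proof -
  have "miss_update M p a $ j = (\<Sum>i\<in>UNIV. p $ i * M $ i $ j - (if i = a then p $ a * M $ a $ j else 0))"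
    unfolding miss_update_def vector_matrix_mult_nth by (intro sum.cong) auto
  then show ?thesis by (simp add: sum_subtractf vector_matrix_mult_nth)
qed

lemma miss_update_nonneg:
  assumes "stochastic_matrix M" "\<And>i. 0 \<le> p $ i"
  shows "0 \<le> miss_update M p a $ j"
  unfolding miss_update_def by (rule vector_matrix_mult_nonneg) (auto simp: assms)

lemma sum_miss_update:
  assumes "stochastic_matrix M"
  shows "(\<Sum>j\<in>UNIV. miss_update M p a $ j) = (\<Sum>i\<in>UNIV. p $ i) - p $ a"
  by (simp add: miss_update_nth sum_subtractf sum_vector_matrix_mult assms
      sum_distrib_left[symmetric] stochastic_sum)

text \<open>Value for a mass vector that need not be normalised; \<open>value_rec u M n\<close> has horizon \<open>n + 1\<close>.\<close>

primrec value_rec ::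
  "('k \<Rightarrow> 'k \<Rightarrow> real) \<Rightarrow> real ^ 'k ^ 'k::finite \<Rightarrow> nat \<Rightarrow> real ^ 'k \<Rightarrow> real" where
  "value_rec u M 0 p = Max (range (\<lambda>a. \<Sum>i\<in>UNIV. p $ i * u i a))"
| "value_rec u M (Suc n) p =
     Max (range (\<lambda>a. p $ a * value_rec u M n (row a M) + value_rec u M n (miss_update M p a)))"

definition continuation_policy :: "'k policy \<Rightarrow> bool \<Rightarrow> 'k policy" where
  "continuation_policy \<xi> b h = \<xi> ((\<xi> [], b) # h)"

lemma history_Cons:
  "history \<xi> (x # xs) (Suc j) =
     (\<xi> [], x = \<xi> []) # history (continuation_policy \<xi> (x = \<xi> [])) xs j"
  by (induction j) (simp_all add: state_def Let_def continuation_policy_def)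

lemma action_Cons:
  "action \<xi> (x # xs) (Suc (Suc j)) = action (continuation_policy \<xi> (x = \<xi> [])) xs (Suc j)"
  unfolding action_def diff_Suc_1 history_Cons by (simp add: continuation_policy_def)

lemma state_Cons: "state (x # xs) (Suc (Suc j)) = state xs (Suc j)"
  by (simp add: state_def)

definition payoff_from ::
  "('k \<Rightarrow> 'k \<Rightarrow> real) \<Rightarrow> real ^ 'k ^ 'k::finite \<Rightarrow> nat \<Rightarrow> 'k policy \<Rightarrow> 'k \<Rightarrow> real" where
  "payoff_from u M n \<xi> x = measure_pmf.expectation (chain_pmf M (row x M) n)
     (\<lambda>xs. u (state (x # xs) (Suc n)) (action \<xi> (x # xs) (Suc n)))"

lemma policy_payoff_eq:
  assumes "q \<in> prob_simplex"
  shows "policy_payoff u M (Suc n) q \<xi> = (\<Sum>x\<in>UNIV. q $ x * payoff_from u M n \<xi> x)"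
  unfolding policy_payoff_def payoff_from_def by (rule expectation_chain_pmf_Suc[OF assms])

lemma payoff_from_0: "payoff_from u M 0 \<xi> x = u x (\<xi> [])"
  by (simp add: payoff_from_def state_def action_def)

lemma row_in_prob_simplex: "stochastic_matrix M \<Longrightarrow> row x M \<in> prob_simplex"
  by (simp add: stochastic_matrix_def)

lemma payoff_from_Suc:
  assumes "stochastic_matrix M"
  shows "payoff_from u M (Suc n) \<xi> x =
    (\<Sum>y\<in>UNIV. M $ x $ y * payoff_from u M n (continuation_policy \<xi> (x = \<xi> [])) y)"
proof -
  have "payoff_from u M (Suc n) \<xi> x =
      policy_payoff u M (Suc n) (row x M) (continuation_policy \<xi> (x = \<xi> []))"
    by (simp only: payoff_from_def policy_payoff_def action_Cons state_Cons)
  then show ?thesis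
    by (simp add: policy_payoff_eq row_in_prob_simplex[OF assms]) (simp add: row_def)
qed

lemma sum_payoff_from_Suc:
  fixes M :: "real ^ 'k ^ 'k::finite" and p :: "real ^ 'k"
  assumes "stochastic_matrix M"
  shows "(\<Sum>x\<in>UNIV. p $ x * payoff_from u M (Suc n) \<xi> x) =
    p $ \<xi> [] * (\<Sum>y\<in>UNIV. row (\<xi> []) M $ y * payoff_from u M n (continuation_policy \<xi> True) y) +
    (\<Sum>y\<in>UNIV. miss_update M p (\<xi> []) $ y * payoff_from u M n (continuation_policy \<xi> False) y)"
proof -
  let ?T = "\<lambda>x. \<Sum>y\<in>UNIV. M $ x $ y * payoff_from u M n (continuation_policy \<xi> True) y"
  let ?F = "\<lambda>x. \<Sum>y\<in>UNIV. M $ x $ y * payoff_from u M n (continuation_policy \<xi> False) y"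
  let ?p = "\<chi> i. if i = \<xi> [] then 0 else p $ i"
  have "(\<Sum>x\<in>UNIV. p $ x * payoff_from u M (Suc n) \<xi> x) =
      (\<Sum>x\<in>UNIV. (if x = \<xi> [] then p $ \<xi> [] * ?T (\<xi> []) else 0) + ?p $ x * ?F x)"
    by (intro sum.cong refl) (simp add: payoff_from_Suc[OF assms])
  also have "\<dots> = p $ \<xi> [] * ?T (\<xi> []) + (\<Sum>x\<in>UNIV. ?p $ x * ?F x)"
    by (simp add: sum.distrib)
  also have "(\<Sum>x\<in>UNIV. ?p $ x * ?F x) =
      (\<Sum>y\<in>UNIV. miss_update M p (\<xi> []) $ y * payoff_from u M n (continuation_policy \<xi> False) y)"
    unfolding miss_update_def vector_matrix_mult_nth sum_distrib_left sum_distrib_right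
    by (subst sum.swap) (simp add: mult.assoc)
  finally show ?thesis by (simp add: row_def)
qed

lemma value_rec_ge:
  "p $ a * value_rec u M n (row a M) + value_rec u M n (miss_update M p a) \<le> value_rec u M (Suc n) p"
  by simp

declare value_rec.simps(2) [simp del]

lemma payoff_le_value_rec:
  fixes M :: "real ^ 'k ^ 'k::finite" and p :: "real ^ 'k"
  assumes st: "stochastic_matrix M" and "\<And>i. 0 \<le> p $ i"
  shows "(\<Sum>x\<in>UNIV. p $ x * payoff_from u M n \<xi> x) \<le> value_rec u M n p"
  using assms(2)
proof (induction n arbitrary: p \<xi>)
  case 0
  then show ?case by (simp add: payoff_from_0)
next
  case (Suc n)
  have "(\<Sum>x\<in>UNIV. p $ x * payoff_from u M (Suc n) \<xi> x) \<le>
      p $ \<xi> [] * value_rec u M n (row (\<xi> []) M) + value_rec u M n (miss_update M p (\<xi> []))"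
    unfolding sum_payoff_from_Suc[OF st]
    using stochastic_nonneg[OF st] miss_update_nonneg[OF st Suc.prems]
    by (intro add_mono mult_left_mono Suc.IH Suc.prems) (auto simp: row_def)
  also have "\<dots> \<le> value_rec u M (Suc n) p" by (rule value_rec_ge)
  finally show ?case .
qed

lemma value_rec_attained:
  fixes M :: "real ^ 'k ^ 'k::finite" and p :: "real ^ 'k"
  assumes st: "stochastic_matrix M"
  shows "\<exists>\<xi>. value_rec u M n p = (\<Sum>x\<in>UNIV. p $ x * payoff_from u M n \<xi> x)"
proof (induction n arbitrary: p)
  case 0
  have "value_rec u M 0 p \<in> range (\<lambda>a. \<Sum>i\<in>UNIV. p $ i * u i a)"
    unfolding value_rec.simps by (rule Max_in) auto
  then obtain a where "value_rec u M 0 p = (\<Sum>i\<in>UNIV. p $ i * u i a)" by blast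
  then show ?case by (intro exI[of _ "\<lambda>_. a"]) (simp add: payoff_from_0)
next
  case (Suc n)
  have "value_rec u M (Suc n) p \<in>
      range (\<lambda>a. p $ a * value_rec u M n (row a M) + value_rec u M n (miss_update M p a))"
    unfolding value_rec.simps by (rule Max_in) auto
  then obtain a where a: "value_rec u M (Suc n) p =
      p $ a * value_rec u M n (row a M) + value_rec u M n (miss_update M p a)" by blast
  obtain \<xi>1 where 1: "value_rec u M n (row a M) =
      (\<Sum>x\<in>UNIV. row a M $ x * payoff_from u M n \<xi>1 x)" using Suc.IH by blast
  obtain \<xi>2 where 2: "value_rec u M n (miss_update M p a) =
      (\<Sum>x\<in>UNIV. miss_update M p a $ x * payoff_from u M n \<xi>2 x)" using Suc.IH by blast
  define \<xi> where "\<xi> h = (case h of [] \<Rightarrow> a | (_, b) # h' \<Rightarrow> if b then \<xi>1 h' else \<xi>2 h')" for h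
  have "\<xi> [] = a" "continuation_policy \<xi> True = \<xi>1" "continuation_policy \<xi> False = \<xi>2"
    by (auto simp: \<xi>_def continuation_policy_def fun_eq_iff)
  then show ?case
    by (intro exI[of _ \<xi>]) (simp add: a 1 2 sum_payoff_from_Suc[OF st])
qed

lemma stage_value_eq:
  fixes M :: "real ^ 'k ^ 'k::finite"
  assumes st: "stochastic_matrix M" and q: "q \<in> prob_simplex"
  shows "stage_value u M (Suc n) q = value_rec u M n q"
  unfolding stage_value_def
proof (rule Max_eqI)
  show "finite (range (policy_payoff u M (Suc n) q))" by (rule finite_range_policy_payoff) simp
  show "value_rec u M n q \<in> range (policy_payoff u M (Suc n) q)"
    using value_rec_attained[OF st, of u n q] by (auto simp: policy_payoff_eq[OF q])
  fix y assume "y \<in> range (policy_payoff u M (Suc n) q)"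
  then show "y \<le> value_rec u M n q"
    using q by (auto simp: policy_payoff_eq[OF q] prob_simplex_def intro!: payoff_le_value_rec[OF st])
qed

text \<open>Before the first hit a policy is just a sequence of guesses.\<close>

primrec miss_mass :: "real ^ 'k ^ 'k::finite \<Rightarrow> nat \<Rightarrow> real ^ 'k \<Rightarrow> real" where
  "miss_mass M 0 q = (\<Sum>i\<in>UNIV. q $ i)"
| "miss_mass M (Suc n) q = Max (range (\<lambda>a. miss_mass M n (miss_update M q a)))"

primrec miss_from :: "real ^ 'k ^ 'k::finite \<Rightarrow> nat \<Rightarrow> 'k policy \<Rightarrow> 'k \<Rightarrow> real" where
  "miss_from M 0 \<xi> x = 1"
| "miss_from M (Suc n) \<xi> x = (if x = \<xi> [] then 0 else
     \<Sum>y\<in>UNIV. M $ x $ y * miss_from M n (continuation_policy \<xi> False) y)"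

lemma miss_prob_eq:
  assumes st: "stochastic_matrix M" and "q \<in> prob_simplex"
  shows "miss_prob M n q \<xi> = (\<Sum>x\<in>UNIV. q $ x * miss_from M n \<xi> x)"
  using assms(2)
proof (induction n arbitrary: q \<xi>)
  case 0
  then show ?case by (simp add: miss_prob_def prob_simplex_def)
next
  case (Suc n)
  define S where "S = {xs. \<forall>j\<in>{1..Suc n}. state xs j \<noteq> action \<xi> xs j}"
  have stages: "{1..Suc n} = insert 1 (Suc ` {1..n})"
    by (simp add: image_Suc_atLeastAtMost atLeastAtMost_insertL)
  have all: "(\<forall>j\<in>{1..Suc n}. P j) \<longleftrightarrow> P 1 \<and> (\<forall>j\<in>{1..n}. P (Suc j))" for P
    unfolding stages by blast
  have tail: "{xs. x # xs \<in> S} = (if x = \<xi> [] then {} else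
      {xs. \<forall>j\<in>{1..n}. state xs j \<noteq> action (continuation_policy \<xi> False) xs j})" for x
  proof -
    have "state (x # xs) (Suc j) = state xs j" if "j \<in> {1..n}" for xs j
      using that state_Cons[of x xs "j - 1"] by simp
    moreover have "action \<xi> (x # xs) (Suc j) = action (continuation_policy \<xi> (x = \<xi> [])) xs j"
      if "j \<in> {1..n}" for xs j
      using that action_Cons[of \<xi> x xs "j - 1"] by simp
    moreover have "state (x # xs) 1 = x" "action \<xi> (x # xs) 1 = \<xi> []" for xs
      by (simp_all add: state_def action_def)
    ultimately show ?thesis unfolding S_def mem_Collect_eq all by auto
  qed
  have "miss_prob M (Suc n) q \<xi> = measure_pmf.expectation (chain_pmf M q (Suc n)) (indicator S)"
    by (simp add: miss_prob_def S_def)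
  also have "\<dots> = (\<Sum>x\<in>UNIV. q $ x *
      measure_pmf.expectation (chain_pmf M (row x M) n) (\<lambda>xs. indicator S (x # xs)))"
    by (rule expectation_chain_pmf_Suc[OF Suc.prems])
  also have "\<dots> = (\<Sum>x\<in>UNIV. q $ x * measure_pmf.prob (chain_pmf M (row x M) n) {xs. x # xs \<in> S})"
  proof -
    have "(\<lambda>xs. indicator S (x # xs) :: real) = indicator {xs. x # xs \<in> S}" for x
      by (auto simp: indicator_def fun_eq_iff)
    then show ?thesis by simp
  qed
  also have "\<dots> = (\<Sum>x\<in>UNIV. q $ x * miss_from M (Suc n) \<xi> x)"
  proof (intro sum.cong refl arg_cong2[of _ _ _ _ "(*)"])
    fix x
    have "miss_prob M n (row x M) (continuation_policy \<xi> False) =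
        (\<Sum>y\<in>UNIV. M $ x $ y * miss_from M n (continuation_policy \<xi> False) y)"
      by (simp add: Suc.IH row_in_prob_simplex[OF st]) (simp add: row_def)
    then show "measure_pmf.prob (chain_pmf M (row x M) n) {xs. x # xs \<in> S} = miss_from M (Suc n) \<xi> x"
      unfolding tail by (simp add: miss_prob_def)
  qed
  finally show ?case .
qed

lemma miss_mass_attained:
  "\<exists>\<xi>. miss_mass M n p = (\<Sum>x\<in>UNIV. p $ x * miss_from M n \<xi> x)"
proof (induction n arbitrary: p)
  case 0
  show ?case by simp
next
  case (Suc n)
  have "miss_mass M (Suc n) p \<in> range (\<lambda>a. miss_mass M n (miss_update M p a))"
    unfolding miss_mass.simps by (rule Max_in) auto
  then obtain a where a: "miss_mass M (Suc n) p = miss_mass M n (miss_update M p a)" by blast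
  obtain \<xi>' where \<xi>': "miss_mass M n (miss_update M p a) =
      (\<Sum>x\<in>UNIV. miss_update M p a $ x * miss_from M n \<xi>' x)" using Suc.IH by blast
  define \<xi> where "\<xi> h = (case h of [] \<Rightarrow> a | _ # h' \<Rightarrow> \<xi>' h')" for h
  have "\<xi> [] = a" "continuation_policy \<xi> False = \<xi>'"
    by (auto simp: \<xi>_def continuation_policy_def fun_eq_iff)
  then have "(\<Sum>x\<in>UNIV. p $ x * miss_from M (Suc n) \<xi> x) = (\<Sum>x\<in>UNIV.
      (\<chi> i. if i = a then 0 else p $ i) $ x * (\<Sum>y\<in>UNIV. M $ x $ y * miss_from M n \<xi>' y))"
    by (intro sum.cong) auto
  also have "\<dots> = (\<Sum>x\<in>UNIV. miss_update M p a $ x * miss_from M n \<xi>' x)"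
    unfolding miss_update_def vector_matrix_mult_nth sum_distrib_left sum_distrib_right
    by (subst sum.swap) (simp add: mult.assoc)
  also have "\<dots> = miss_mass M (Suc n) p" by (simp only: a \<xi>')
  finally show ?case by metis
qed

lemma miss_prob_le_max_miss_prob:
  fixes M :: "real ^ 'k ^ 'k::finite"
  assumes "q \<in> prob_simplex"
  shows "miss_prob M n q \<xi> \<le> max_miss_prob M n"
proof -
  have "miss_prob M n q \<xi> \<le> Max (range (miss_prob M n q))"
    by (rule Max_ge[OF finite_range_miss_prob]) simp
  also have "\<dots> \<le> max_miss_prob M n"
    unfolding max_miss_prob_def
  proof (rule cSUP_upper[OF assms])
    have "Max (range (miss_prob M n q)) \<le> 1" for q
      by (rule Max.boundedI[OF finite_range_miss_prob]) (auto simp: miss_prob_def)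
    then show "bdd_above ((\<lambda>q. Max (range (miss_prob M n q))) ` prob_simplex)"
      by (intro bdd_aboveI2[of _ _ 1])
  qed
  finally show ?thesis .
qed

lemma miss_mass_le_max_miss_prob:
  assumes "stochastic_matrix M" "q \<in> prob_simplex"
  shows "miss_mass M n q \<le> max_miss_prob M n"
  using miss_mass_attained[of M n q] miss_prob_le_max_miss_prob[OF assms(2), of M n]
  by (auto simp: miss_prob_eq[OF assms])

section \<open>Comparing values of different priors and horizons\<close>

text \<open>The value \<open>explore u M n x\<close> of guessing uniformly at random until the first hit, with payoff 0
  if there is no hit, is linear in the prior.\<close>

primrec explore ::
  "('k \<Rightarrow> 'k \<Rightarrow> real) \<Rightarrow> real ^ 'k ^ 'k::finite \<Rightarrow> nat \<Rightarrow> 'k \<Rightarrow> real" where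
  "explore u M 0 x = 0"
| "explore u M (Suc n) x = value_rec u M n (row x M) / real CARD('k) +
     (1 - 1 / real CARD('k)) * (\<Sum>y\<in>UNIV. M $ x $ y * explore u M n y)"

context
  fixes M :: "real ^ 'k ^ 'k::finite" and u :: "'k \<Rightarrow> 'k \<Rightarrow> real"
  assumes st: "stochastic_matrix M"
begin

lemma payoff_from_le_known: "payoff_from u M n \<xi> x \<le> value_rec u M n (axis x 1)"
proof -
  have "(\<Sum>y\<in>UNIV. axis x 1 $ y * payoff_from u M n \<xi> y) \<le> value_rec u M n (axis x 1)"
    by (rule payoff_le_value_rec[OF st]) (auto simp: axis_def)
  moreover have "(\<Sum>y\<in>UNIV. axis x 1 $ y * payoff_from u M n \<xi> y) =
      (\<Sum>y\<in>UNIV. if y = x then payoff_from u M n \<xi> y else 0)"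
    by (intro sum.cong) (auto simp: axis_def)
  ultimately show ?thesis by simp
qed

lemma value_rec_le_known:
  assumes "\<And>i. 0 \<le> p $ i"
  shows "value_rec u M n p \<le> (\<Sum>x\<in>UNIV. p $ x * value_rec u M n (axis x 1))"
proof -
  obtain \<xi> where "value_rec u M n p = (\<Sum>x\<in>UNIV. p $ x * payoff_from u M n \<xi> x)"
    using value_rec_attained[OF st] by blast
  also have "\<dots> \<le> (\<Sum>x\<in>UNIV. p $ x * value_rec u M n (axis x 1))"
    by (intro sum_mono mult_left_mono payoff_from_le_known assms)
  finally show ?thesis .
qed

lemma value_rec_known_Suc: "value_rec u M (Suc n) (axis x 1) \<le> value_rec u M n (row x M)"
proof -
  obtain \<xi> where "value_rec u M (Suc n) (axis x 1) =
      (\<Sum>y\<in>UNIV. axis x 1 $ y * payoff_from u M (Suc n) \<xi> y)"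
    using value_rec_attained[OF st] by blast
  also have "\<dots> = (\<Sum>y\<in>UNIV. if y = x then payoff_from u M (Suc n) \<xi> y else 0)"
    by (intro sum.cong) (auto simp: axis_def)
  also have "\<dots> = (\<Sum>y\<in>UNIV. row x M $ y *
      payoff_from u M n (continuation_policy \<xi> (x = \<xi> [])) y)"
    by (simp add: payoff_from_Suc[OF st] row_def)
  also have "\<dots> \<le> value_rec u M n (row x M)"
    by (rule payoff_le_value_rec[OF st]) (simp add: row_def stochastic_nonneg[OF st])
  finally show ?thesis .
qed

lemma value_rec_row_le_known:
  "value_rec u M n (row x M) \<le> (\<Sum>y\<in>UNIV. M $ x $ y * value_rec u M n (axis y 1))"
  using value_rec_le_known[of "row x M"] by (simp add: row_def stochastic_nonneg[OF st])

lemma value_rec_step: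
  assumes "\<And>i. 0 \<le> p $ i"
  shows "value_rec u M n (p v* M) \<le> value_rec u M (Suc n) p"
proof -
  fix a \<comment> \<open>an arbitrary first action, whose signal is ignored\<close>
  obtain \<xi> where "value_rec u M n (p v* M) = (\<Sum>x\<in>UNIV. (p v* M) $ x * payoff_from u M n \<xi> x)"
    using value_rec_attained[OF st] by blast
  also have "\<dots> = (\<Sum>x\<in>UNIV. p $ a * (row a M $ x * payoff_from u M n \<xi> x) +
      miss_update M p a $ x * payoff_from u M n \<xi> x)"
    by (intro sum.cong) (auto simp: miss_update_nth row_def algebra_simps)
  also have "\<dots> = p $ a * (\<Sum>x\<in>UNIV. row a M $ x * payoff_from u M n \<xi> x) +
      (\<Sum>x\<in>UNIV. miss_update M p a $ x * payoff_from u M n \<xi> x)"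
    by (simp add: sum.distrib sum_distrib_left)
  also have "\<dots> \<le> p $ a * value_rec u M n (row a M) + value_rec u M n (miss_update M p a)"
    by (intro add_mono mult_left_mono payoff_le_value_rec[OF st] assms miss_update_nonneg[OF st])
      (simp add: row_def stochastic_nonneg[OF st])
  also have "\<dots> \<le> value_rec u M (Suc n) p" by (rule value_rec_ge)
  finally show ?thesis .
qed

lemma value_rec_mat_power:
  assumes "\<And>i. 0 \<le> q $ i"
  shows "value_rec u M n (q v* mat_power M m) \<le> value_rec u M (n + m) q"
  using assms
proof (induction m arbitrary: q)
  case (Suc m)
  have "value_rec u M n (q v* mat_power M (Suc m)) = value_rec u M n ((q v* M) v* mat_power M m)"
    by (simp add: mat_power_Suc vector_matrix_mul_assoc)
  also have "\<dots> \<le> value_rec u M (n + m) (q v* M)"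
    by (intro Suc.IH vector_matrix_mult_nonneg[OF st] Suc.prems)
  also have "\<dots> \<le> value_rec u M (n + Suc m) q" using value_rec_step[OF Suc.prems] by simp
  finally show ?case .
qed simp

context
  assumes u: "\<forall>x a. u x a \<in> {0..1}"
begin

lemma payoff_from_bounds: "payoff_from u M n \<xi> x \<in> {0..1}"
  unfolding payoff_from_def
  using u by (auto intro!: measure_pmf.integral_ge_const measure_pmf.integral_le_const
      integrable_measure_pmf_finite finite_set_chain_pmf)

lemma value_rec_le_sum:
  assumes "\<And>i. 0 \<le> p $ i"
  shows "value_rec u M n p \<le> (\<Sum>i\<in>UNIV. p $ i)"
proof -
  obtain \<xi> where "value_rec u M n p = (\<Sum>x\<in>UNIV. p $ x * payoff_from u M n \<xi> x)"
    using value_rec_attained[OF st] by blast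
  also have "\<dots> \<le> (\<Sum>x\<in>UNIV. p $ x * 1)"
    using payoff_from_bounds assms by (intro sum_mono mult_left_mono) auto
  finally show ?thesis by simp
qed

lemma value_rec_nonneg:
  assumes "\<And>i. 0 \<le> p $ i"
  shows "0 \<le> value_rec u M n p"
proof -
  have "0 \<le> (\<Sum>x\<in>UNIV. p $ x * payoff_from u M n undefined x)"
    using payoff_from_bounds assms by (intro sum_nonneg mult_nonneg_nonneg) auto
  also have "\<dots> \<le> value_rec u M n p" by (rule payoff_le_value_rec[OF st assms])
  finally show ?thesis .
qed

lemma value_rec_l1_lipschitz:
  assumes "\<And>i. 0 \<le> q $ i"
  shows "value_rec u M n p - value_rec u M n q \<le> l1_norm (p - q)"
proof -
  obtain \<xi> where "value_rec u M n p = (\<Sum>x\<in>UNIV. p $ x * payoff_from u M n \<xi> x)"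
    using value_rec_attained[OF st] by blast
  moreover have "(\<Sum>x\<in>UNIV. q $ x * payoff_from u M n \<xi> x) \<le> value_rec u M n q"
    by (rule payoff_le_value_rec[OF st assms])
  ultimately have "value_rec u M n p - value_rec u M n q \<le>
      (\<Sum>x\<in>UNIV. (p - q) $ x * payoff_from u M n \<xi> x)"
    by (simp add: left_diff_distrib sum_subtractf)
  also have "\<dots> \<le> (\<Sum>x\<in>UNIV. \<bar>(p - q) $ x\<bar> * 1)"
    using payoff_from_bounds
    by (intro sum_mono mult_mono) auto
  finally show ?thesis by (simp add: l1_norm_def)
qed

lemma explore_le_value_rec:
  assumes "\<And>i. 0 \<le> p $ i"
  shows "(\<Sum>x\<in>UNIV. p $ x * explore u M n x) \<le> value_rec u M n p"
  using assms
proof (induction n arbitrary: p)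
  case 0
  then show ?case using value_rec_nonneg[of p 0] by simp
next
  case (Suc n)
  let ?k = "real CARD('k)"
  let ?E = "\<lambda>x. \<Sum>y\<in>UNIV. M $ x $ y * explore u M n y"
  have *: "p $ a * value_rec u M n (row a M) + (\<Sum>x\<in>UNIV. p $ x * ?E x) - p $ a * ?E a
      \<le> value_rec u M (Suc n) p" for a
  proof -
    have "(\<Sum>x\<in>UNIV. p $ x * ?E x) - p $ a * ?E a = (\<Sum>y\<in>UNIV. miss_update M p a $ y * explore u M n y)"
      unfolding miss_update_nth vector_matrix_mult_nth left_diff_distrib sum_subtractf
        sum_distrib_left sum_distrib_right
      by (subst sum.swap) (simp add: mult.assoc)
    also have "\<dots> \<le> value_rec u M n (miss_update M p a)"
      by (intro Suc.IH miss_update_nonneg[OF st] Suc.prems)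
    finally show ?thesis using value_rec_ge[of p a u M n] by simp
  qed
  have "(\<Sum>a\<in>UNIV. p $ a * value_rec u M n (row a M) + (\<Sum>x\<in>UNIV. p $ x * ?E x) - p $ a * ?E a) \<le>
      (\<Sum>a\<in>(UNIV::'k set). value_rec u M (Suc n) p)"
    by (intro sum_mono *)
  then have "(\<Sum>a\<in>UNIV. p $ a * value_rec u M n (row a M)) + (?k - 1) * (\<Sum>x\<in>UNIV. p $ x * ?E x) \<le>
      ?k * value_rec u M (Suc n) p"
    by (simp add: sum.distrib sum_subtractf algebra_simps)
  moreover have "(\<Sum>x\<in>UNIV. p $ x * explore u M (Suc n) x) =
      ((\<Sum>a\<in>UNIV. p $ a * value_rec u M n (row a M)) + (?k - 1) * (\<Sum>x\<in>UNIV. p $ x * ?E x)) / ?k"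
  proof -
    have "p $ x * explore u M (Suc n) x =
        (p $ x * value_rec u M n (row x M) + (?k - 1) * (p $ x * ?E x)) / ?k" for x
      by (simp add: field_simps)
    then show ?thesis by (simp add: sum_divide_distrib[symmetric] sum.distrib sum_distrib_left)
  qed
  ultimately show ?case by (simp add: divide_le_eq mult.commute)
qed

text \<open>Guess along a simulated path of the chain started from \<open>x\<close>.  At the first hit the two chains have met, and from then on the
  decision maker is at least as well off as one who started from \<open>x\<close>.\<close>

lemma known_le_value_rec_plus_miss:
  assumes "\<And>i. 0 \<le> q $ i"
  shows "(\<Sum>i\<in>UNIV. q $ i) * value_rec u M n (axis x 1) \<le> value_rec u M n q + miss_mass M n q"
  using assms
proof (induction n arbitrary: q x)
  case 0
  have "value_rec u M 0 (axis x 1) \<le> 1"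
    using value_rec_le_sum[of "axis x 1" 0] by (simp add: axis_def if_distrib)
  then have "(\<Sum>i\<in>UNIV. q $ i) * value_rec u M 0 (axis x 1) \<le> (\<Sum>i\<in>UNIV. q $ i) * 1"
    by (intro mult_left_mono sum_nonneg 0)
  then show ?case using value_rec_nonneg[OF 0, of 0] by simp
next
  case (Suc n)
  let ?q = "miss_update M q x"
  let ?s = "\<Sum>i\<in>UNIV. ?q $ i"
  have q: "0 \<le> ?q $ i" for i by (intro miss_update_nonneg[OF st] Suc.prems)
  have "?s * value_rec u M (Suc n) (axis x 1) \<le> ?s * (\<Sum>y\<in>UNIV. M $ x $ y * value_rec u M n (axis y 1))"
    using value_rec_known_Suc value_rec_row_le_known order_trans
    by (blast intro: mult_left_mono sum_nonneg q)
  also have "\<dots> = (\<Sum>y\<in>UNIV. M $ x $ y * (?s * value_rec u M n (axis y 1)))"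
    by (simp add: sum_distrib_left mult.left_commute)
  also have "\<dots> \<le> (\<Sum>y\<in>UNIV. M $ x $ y * (value_rec u M n ?q + miss_mass M n ?q))"
    by (intro sum_mono mult_left_mono Suc.IH q stochastic_nonneg[OF st])
  also have "\<dots> = value_rec u M n ?q + miss_mass M n ?q"
    by (simp add: sum_distrib_right[symmetric] stochastic_sum[OF st])
  also have "\<dots> \<le> value_rec u M n ?q + miss_mass M (Suc n) q" by simp
  finally have miss: "?s * value_rec u M (Suc n) (axis x 1) \<le> value_rec u M n ?q + miss_mass M (Suc n) q" .
  have hit: "q $ x * value_rec u M (Suc n) (axis x 1) \<le> q $ x * value_rec u M n (row x M)"
    by (intro mult_left_mono value_rec_known_Suc Suc.prems)
  have "(\<Sum>i\<in>UNIV. q $ i) * value_rec u M (Suc n) (axis x 1) =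
      q $ x * value_rec u M (Suc n) (axis x 1) + ?s * value_rec u M (Suc n) (axis x 1)"
    by (simp add: sum_miss_update[OF st] algebra_simps)
  then show ?case
    using hit miss value_rec_ge[of q x u M n] by linarith
qed

end

end

section \<open>The stationary prior\<close>

context
  fixes M :: "real ^ 'k ^ 'k::finite" and u :: "'k \<Rightarrow> 'k \<Rightarrow> real" and \<pi> :: "real ^ 'k"
  assumes st: "stochastic_matrix M" and u: "\<forall>x a. u x a \<in> {0..1}"
    and inv: "invariant_distribution M \<pi>"
begin

lemma invariant_nonneg: "0 \<le> \<pi> $ i"
  and invariant_sum: "(\<Sum>i\<in>UNIV. \<pi> $ i) = 1"
  and invariant_mult: "\<pi> v* M = \<pi>"
  and invariant_in_simplex: "\<pi> \<in> prob_simplex"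
  using inv by (auto simp: invariant_distribution_def prob_simplex_def)

lemma value_invariant_mono: "incseq (\<lambda>n. value_rec u M n \<pi>)"
  using value_rec_step[OF st invariant_nonneg, where u = u]
  by (intro incseq_SucI) (simp add: invariant_mult)

lemma value_invariant_le_one: "value_rec u M n \<pi> \<le> 1"
  using value_rec_le_sum[OF st u invariant_nonneg, where n = n] by (simp add: invariant_sum)

lemma value_invariant_bdd: "bdd_above (range (\<lambda>n. value_rec u M n \<pi>))"
  using value_invariant_le_one by (intro bdd_aboveI2[of _ _ 1])

lemma limit_value_eq: "limit_value u M \<pi> = (SUP n. value_rec u M n \<pi>)"
proof -
  have "(\<lambda>n. stage_value u M (Suc n) \<pi>) \<longlonglongrightarrow> (SUP n. value_rec u M n \<pi>)"
    using LIMSEQ_incseq_SUP[OF value_invariant_bdd value_invariant_mono]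
    by (simp add: stage_value_eq[OF st invariant_in_simplex])
  then have "(\<lambda>n. stage_value u M n \<pi>) \<longlonglongrightarrow> (SUP n. value_rec u M n \<pi>)"
    by (rule LIMSEQ_imp_Suc)
  then show ?thesis
    unfolding limit_value_def by (rule limI)
qed

lemma limit_value_le_one: "limit_value u M \<pi> \<le> 1"
  unfolding limit_value_eq by (intro cSUP_least value_invariant_le_one) simp

lemma value_invariant_le_limit: "value_rec u M n \<pi> \<le> limit_value u M \<pi>"
  unfolding limit_value_eq by (rule cSUP_upper[OF _ value_invariant_bdd]) simp

text \<open>Value from \<open>\<pi>\<close> when the first state is revealed; a longer horizon makes this information older.\<close>

definition informed_value :: "nat \<Rightarrow> real" where
  "informed_value n = (\<Sum>x\<in>UNIV. \<pi> $ x * value_rec u M n (axis x 1))"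

lemma sum_invariant_mult:
  "(\<Sum>x\<in>UNIV. \<pi> $ x * (\<Sum>y\<in>UNIV. M $ x $ y * f y)) = (\<Sum>y\<in>UNIV. \<pi> $ y * f y)"
proof -
  have "(\<Sum>x\<in>UNIV. \<pi> $ x * (\<Sum>y\<in>UNIV. M $ x $ y * f y)) = (\<Sum>y\<in>UNIV. (\<pi> v* M) $ y * f y)"
    unfolding vector_matrix_mult_nth sum_distrib_left sum_distrib_right
    by (subst sum.swap) (simp add: mult.assoc)
  then show ?thesis by (simp add: invariant_mult)
qed

lemma informed_value_Suc_le:
  "informed_value (Suc n) \<le> (\<Sum>x\<in>UNIV. \<pi> $ x * value_rec u M n (row x M))"
  unfolding informed_value_def
  by (intro sum_mono mult_left_mono value_rec_known_Suc[OF st] invariant_nonneg)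

lemma informed_value_antimono: "decseq informed_value"
proof (rule decseq_SucI)
  fix n
  have "(\<Sum>x\<in>UNIV. \<pi> $ x * value_rec u M n (row x M)) \<le> (\<Sum>x\<in>UNIV. \<pi> $ x *
      (\<Sum>y\<in>UNIV. M $ x $ y * value_rec u M n (axis y 1)))"
    by (intro sum_mono mult_left_mono value_rec_row_le_known[OF st] invariant_nonneg)
  then show "informed_value (Suc n) \<le> informed_value n"
    using informed_value_Suc_le[of n] by (simp add: sum_invariant_mult informed_value_def)
qed

lemma limit_value_le_informed: "limit_value u M \<pi> \<le> informed_value n"
proof -
  have "value_rec u M N \<pi> \<le> informed_value n" for N
  proof -
    have "value_rec u M N \<pi> \<le> value_rec u M (max n N) \<pi>"
      by (rule incseqD[OF value_invariant_mono]) simp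
    also have "\<dots> \<le> informed_value (max n N)"
      unfolding informed_value_def by (rule value_rec_le_known[OF st invariant_nonneg])
    also have "\<dots> \<le> informed_value n" by (rule decseqD[OF informed_value_antimono]) simp
    finally show ?thesis .
  qed
  then show ?thesis unfolding limit_value_eq by (intro cSUP_least) auto
qed

lemma limit_value_le_value_rec:
  "limit_value u M \<pi> \<le> value_rec u M n \<pi> + (1 - 1 / real CARD('k)) ^ n"
proof -
  let ?v = "limit_value u M \<pi>"
  let ?r = "1 - 1 / real CARD('k)"
  have r: "0 \<le> ?r" by simp
  have "(1 - ?r ^ n) * ?v \<le> (\<Sum>x\<in>UNIV. \<pi> $ x * explore u M n x)"
  proof (induction n)
    case 0
    then show ?case by simp
  next
    case (Suc n)
    have "(1 - ?r ^ Suc n) * ?v = ?v / CARD('k) + ?r * ((1 - ?r ^ n) * ?v)"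
      by (simp add: field_simps)
    also have "\<dots> \<le> (\<Sum>x\<in>UNIV. \<pi> $ x * value_rec u M n (row x M)) / CARD('k) +
        ?r * (\<Sum>x\<in>UNIV. \<pi> $ x * explore u M n x)"
      using limit_value_le_informed[of "Suc n"] informed_value_Suc_le[of n]
      by (intro add_mono divide_right_mono mult_left_mono Suc r) auto
    also have "\<dots> = (\<Sum>x\<in>UNIV. \<pi> $ x * explore u M (Suc n) x)"
    proof -
      have "\<pi> $ x * explore u M (Suc n) x = \<pi> $ x * value_rec u M n (row x M) / CARD('k) +
          ?r * (\<pi> $ x * (\<Sum>y\<in>UNIV. M $ x $ y * explore u M n y))" for x
        by (simp add: algebra_simps)
      then show ?thesis
        by (simp only: sum.distrib sum_distrib_left[symmetric] sum_divide_distrib[symmetric]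
            sum_invariant_mult)
    qed
    finally show ?case .
  qed
  also have "\<dots> \<le> value_rec u M n \<pi>"
    by (rule explore_le_value_rec[OF st u invariant_nonneg])
  finally have "?v \<le> value_rec u M n \<pi> + ?r ^ n * ?v" by (simp add: algebra_simps)
  also have "?r ^ n * ?v \<le> ?r ^ n * 1"
    by (intro mult_left_mono limit_value_le_one zero_le_power r)
  finally show ?thesis by simp
qed

end

lemma l1_norm_le_mixing_distance:
  fixes M :: "real ^ 'k ^ 'k::finite"
  assumes "q \<in> prob_simplex"
  shows "l1_norm (q v* mat_power M n - \<pi>) \<le> mixing_distance M \<pi> n"
  unfolding mixing_distance_def
proof (rule cSUP_upper[OF assms])
  let ?A = "mat_power M n"
  have "l1_norm (q v* ?A - \<pi>) \<le> (\<Sum>j\<in>UNIV. (\<Sum>i\<in>UNIV. \<bar>?A $ i $ j\<bar>) + \<bar>\<pi> $ j\<bar>)"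
    if q: "q \<in> prob_simplex" for q
    unfolding l1_norm_def
  proof (rule sum_mono)
    fix j
    have q01: "0 \<le> q $ i" "q $ i \<le> 1" for i
      using q member_le_sum[of i UNIV "\<lambda>i. q $ i"] by (auto simp: prob_simplex_def)
    have "\<bar>\<Sum>i\<in>UNIV. q $ i * ?A $ i $ j\<bar> \<le> (\<Sum>i\<in>UNIV. \<bar>q $ i * ?A $ i $ j\<bar>)"
      by (rule sum_abs)
    also have "\<dots> \<le> (\<Sum>i\<in>UNIV. \<bar>?A $ i $ j\<bar>)"
      by (intro sum_mono) (simp add: abs_mult q01 mult_left_le_one_le)
    finally have "\<bar>(q v* ?A) $ j\<bar> \<le> (\<Sum>i\<in>UNIV. \<bar>?A $ i $ j\<bar>)"
      by (simp add: vector_matrix_mult_nth)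
    then show "\<bar>(q v* ?A - \<pi>) $ j\<bar> \<le> (\<Sum>i\<in>UNIV. \<bar>?A $ i $ j\<bar>) + \<bar>\<pi> $ j\<bar>"
      using abs_triangle_ineq4[of "(q v* ?A) $ j" "\<pi> $ j"] by simp
  qed
  then show "bdd_above ((\<lambda>q. l1_norm (q v* ?A - \<pi>)) ` prob_simplex)"
    by (rule bdd_aboveI2)
qed

lemma invariant_mat_power:
  assumes "invariant_distribution M \<pi>"
  shows "\<pi> v* mat_power M n = \<pi>"
proof (induction n)
  case (Suc n)
  have "\<pi> v* mat_power M (Suc n) = (\<pi> v* M) v* mat_power M n"
    by (simp add: mat_power_Suc vector_matrix_mul_assoc)
  then show ?case using assms Suc by (simp add: invariant_distribution_def)
qed simp

lemma invariant_distribution_pos: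
  fixes M :: "real ^ 'k ^ 'k::finite"
  assumes "stochastic_matrix M" "irreducible_matrix M" "aperiodic_matrix M"
    and inv: "invariant_distribution M \<pi>"
  shows "0 < \<pi> $ j"
proof -
  let ?A = "mat_power M (CARD('k) ^ 2)"
  have nn: "0 \<le> \<pi> $ i" for i
    using inv by (auto simp: invariant_distribution_def prob_simplex_def)
  have sum: "(\<Sum>i\<in>UNIV. \<pi> $ i) = 1"
    using inv by (auto simp: invariant_distribution_def prob_simplex_def)
  obtain i where "\<pi> $ i \<noteq> 0" using sum by (metis sum.neutral zero_neq_one)
  with nn[of i] have "0 < \<pi> $ i" by simp
  then have "0 < (\<Sum>i\<in>UNIV. \<pi> $ i * ?A $ i $ j)"
    using mat_power_card_squared_pos[OF assms(1-3)] nn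
    by (intro sum_pos2[of _ i]) (auto simp: less_imp_le)
  then show ?thesis
    using invariant_mat_power[OF inv, of "CARD('k) ^ 2"] by (metis vector_matrix_mult_nth)
qed

lemma le_divide_unit:
  fixes x c :: real
  assumes "0 < c" "c \<le> 1" "0 \<le> x"
  shows "x \<le> x / c"
  using assms by (simp add: le_divide_eq mult_left_le)

theorem theorem3:
  fixes M :: "real ^ 'k ^ 'k::finite"
    and u :: "'k \<Rightarrow> 'k \<Rightarrow> real"
    and \<pi> q :: "real ^ 'k"
    and n :: nat
  assumes "stochastic_matrix M"
    and "irreducible_matrix M"
    and "aperiodic_matrix M"
    and "invariant_distribution M \<pi>"
    and "\<And>x a. u x a \<in> {0..1}"
    and "q \<in> prob_simplex"
    and "n \<ge> 2"
  shows "stage_value u M n q - limit_value u M \<pi>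
           \<ge> - (mixing_distance M \<pi> (nat \<lceil>real n / 2\<rceil>) / Min (range (\<lambda>i. \<pi> $ i)))
               - (1 - 1 / real CARD('k)) ^ (nat \<lfloor>real n / 2\<rfloor> - 1)
       \<and> stage_value u M n q - limit_value u M \<pi>
           \<le> max_miss_prob M (n - 1) / min_entry (mat_power M (CARD('k) ^ 2))
               + (1 - 1 / real CARD('k)) ^ (n - 2)"
proof (rule conjI)
  note st = assms(1) and inv = assms(4)
  have u: "\<forall>x a. u x a \<in> {0..1}" using assms(5) by blast
  have q: "0 \<le> q $ i" for i using assms(6) by (simp add: prob_simplex_def)
  have \<pi>: "\<pi> \<in> prob_simplex" "0 \<le> \<pi> $ i" "(\<Sum>i\<in>UNIV. \<pi> $ i) = 1" for i
    using inv by (auto simp: invariant_distribution_def prob_simplex_def)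
  have stage: "stage_value u M n q = value_rec u M (n - 1) q"
    using stage_value_eq[OF st assms(6), of u "n - 1"] assms(7) by simp
  let ?v = "limit_value u M \<pi>"
  let ?r = "1 - 1 / real CARD('k)"
  define a b where "a = nat \<lceil>real n / 2\<rceil>" and "b = nat \<lfloor>real n / 2\<rfloor>"
  have ab: "(b - 1) + a = n - 1"
    using assms(7) unfolding a_def b_def by linarith
  let ?d = "mixing_distance M \<pi> a"
  let ?p = "q v* mat_power M a"
  have "?v \<le> value_rec u M (b - 1) \<pi> + ?r ^ (b - 1)"
    by (rule limit_value_le_value_rec[OF st u inv])
  moreover have "value_rec u M (b - 1) \<pi> \<le> value_rec u M (b - 1) ?p + l1_norm (\<pi> - ?p)"
    using value_rec_l1_lipschitz[OF st u vector_matrix_mult_nonneg[OF stochastic_mat_power[OF st, of a] q],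
        where n = "b - 1" and p = \<pi>] by simp
  moreover have "l1_norm (\<pi> - ?p) = l1_norm (?p - \<pi>)"
    by (simp add: l1_norm_def abs_minus_commute)
  moreover have "l1_norm (?p - \<pi>) \<le> ?d" by (rule l1_norm_le_mixing_distance[OF assms(6)])
  moreover have "value_rec u M (b - 1) ?p \<le> value_rec u M (n - 1) q"
    using value_rec_mat_power[OF st q, where n = "b - 1" and m = a and u = u] by (simp only: ab)
  moreover have "?d \<le> ?d / Min (range (\<lambda>i. \<pi> $ i))"
  proof (rule le_divide_unit)
    show "0 < Min (range (\<lambda>i. \<pi> $ i))"
      using invariant_distribution_pos[OF assms(1-4)] by simp
    have "Min (range (\<lambda>i. \<pi> $ i)) \<le> \<pi> $ i" for i by simp
    moreover have "\<pi> $ i \<le> 1" for i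
      using member_le_sum[of i UNIV "\<lambda>i. \<pi> $ i"] \<pi> by simp
    ultimately show "Min (range (\<lambda>i. \<pi> $ i)) \<le> 1" using order_trans by blast
    have "0 \<le> l1_norm (?p - \<pi>)" by (simp add: l1_norm_def sum_nonneg)
    also have "\<dots> \<le> ?d" by (rule l1_norm_le_mixing_distance[OF assms(6)])
    finally show "0 \<le> ?d" .
  qed
  ultimately have "?v \<le> value_rec u M (n - 1) q + ?d / Min (range (\<lambda>i. \<pi> $ i)) + ?r ^ (b - 1)"
    by linarith
  then show "stage_value u M n q - ?v
      \<ge> - (mixing_distance M \<pi> (nat \<lceil>real n / 2\<rceil>) / Min (range (\<lambda>i. \<pi> $ i)))
          - ?r ^ (nat \<lfloor>real n / 2\<rfloor> - 1)"
    unfolding stage a_def b_def by linarith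

  let ?W = "max_miss_prob M (n - 1)"
  let ?A = "mat_power M (CARD('k) ^ 2)"
  have known: "value_rec u M (n - 1) (axis x 1) \<le> value_rec u M (n - 1) \<pi> + ?W" for x
    using known_le_value_rec_plus_miss[OF st u \<pi>(2), where n = "n - 1" and x = x]
      miss_mass_le_max_miss_prob[OF st \<pi>(1), of "n - 1"] by (simp add: \<pi>(3))
  have "value_rec u M (n - 1) q \<le> (\<Sum>x\<in>UNIV. q $ x * value_rec u M (n - 1) (axis x 1))"
    by (rule value_rec_le_known[OF st q])
  also have "\<dots> \<le> (\<Sum>x\<in>UNIV. q $ x * (value_rec u M (n - 1) \<pi> + ?W))"
    by (intro sum_mono mult_left_mono known q)
  also have "\<dots> = value_rec u M (n - 1) \<pi> + ?W"
    using assms(6) by (simp add: sum_distrib_right[symmetric] prob_simplex_def)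
  finally have "value_rec u M (n - 1) q \<le> value_rec u M (n - 1) \<pi> + ?W" .
  moreover have "value_rec u M (n - 1) \<pi> \<le> ?v"
    by (rule value_invariant_le_limit[OF st u inv])
  moreover have "?W \<le> ?W / min_entry ?A"
  proof (rule le_divide_unit)
    have fin: "finite {?A $ i $ j | i j. True}"
      by (rule finite_subset[of _ "range (\<lambda>(i, j). ?A $ i $ j)"]) auto
    have "min_entry ?A \<in> {?A $ i $ j | i j. True}"
      unfolding min_entry_def by (rule Min_in[OF fin]) auto
    then obtain i j where "min_entry ?A = ?A $ i $ j" by blast
    then show "0 < min_entry ?A" "min_entry ?A \<le> 1"
      using mat_power_card_squared_pos[OF assms(1-3)]
        stochastic_le_one[OF stochastic_mat_power[OF st]] by simp_all
    have "0 \<le> miss_prob M (n - 1) \<pi> undefined" by (simp add: miss_prob_def)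
    then show "0 \<le> ?W" using miss_prob_le_max_miss_prob[OF \<pi>(1)] by (rule order_trans)
  qed
  moreover have "0 \<le> ?r ^ (n - 2)" by simp
  ultimately show "stage_value u M n q - ?v \<le> ?W / min_entry ?A + ?r ^ (n - 2)"
    unfolding stage by linarith
qed

end
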